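(* Let $a,b\in\mathbb{R}$ with $a\neq0$ and $b\neq 0$. There exist real numbers $s\geq0$, $k$, $\omega$ such that the system $$\left\{\begin{array}{l} iu_t+u_{xx}=|u|^2u+buv,\\[2pt] v_t+a\Big(\int_{\mathbb{R}^+}v^2\,dx\Big)v_x=-b(|u|^2)_x\end{array}\right.$$ on $\mathbb{R}^+$ admits a smooth solution $(u,v)$ of the form $$u(x,t)=e^{i(\omega t+kx)}r(x+st),\qquad v(x,t)=w(x+st),$$ where $r,w$ are real-valued functions defined on $[0,+\infty)$, such that - $r(0)=0$, $r\in L^\infty(\mathbb{R}^+)\cap C^\infty(\mathbb{R}^+)$ and $r$ is increasing; - $v(\cdot,t)\in L^2(\mathbb{R}^+)\cap C^\infty(\mathbb{R}^+)$ for every $t\ge 0$.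
   Context: $\mathbb{R}^+=(0,+\infty)$; $u=u(x,t)$ is complex-valued, $v=v(x,t)$ is real-valued, $x\in\mathbb{R}^+$, $t\geq0$, and $\int_{\mathbb{R}^+}v^2dx=\int_{\mathbb{R}^+}v^2(x,t)dx$. *)

theory Defs
  imports "HOL-Analysis.Analysis"
begin

abbreviation Rplus :: "real set" where
  "Rplus \<equiv> {0<..}"

text \<open>
  \<open>Ck_on n S f\<close>: the function \<open>f\<close> is \<open>n\<close> times continuously differentiable on \<open>S\<close>, with partial
  derivatives \<open>D i\<close> in the coordinate directions. Derivatives are taken within \<open>S\<close>; the sets used
  are convex with nonempty interior, so these derivatives are unique, and they are one-sided at
  the boundary points belonging to \<open>S\<close> (such as \<open>t = 0\<close>).
\<close>

primrec Ck_on :: "nat \<Rightarrow> 'a::euclidean_space set \<Rightarrow> ('a \<Rightarrow> 'b::real_normed_vector) \<Rightarrow> bool" where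
  "Ck_on 0 S f \<longleftrightarrow> continuous_on S f"
| "Ck_on (Suc n) S f \<longleftrightarrow>
     (\<exists>D. (\<forall>i\<in>Basis. Ck_on n S (D i)) \<and>
          (\<forall>x\<in>S. (f has_derivative (\<lambda>h. \<Sum>i\<in>Basis. (h \<bullet> i) *\<^sub>R D i x)) (at x within S)))"

definition Cinf_on :: "'a::euclidean_space set \<Rightarrow> ('a \<Rightarrow> 'b::real_normed_vector) \<Rightarrow> bool" where
  "Cinf_on S f \<longleftrightarrow> (\<forall>n. Ck_on n S f)"

definition L2_on :: "real set \<Rightarrow> (real \<Rightarrow> real) \<Rightarrow> bool" where
  "L2_on S f \<longleftrightarrow> f \<in> borel_measurable (lebesgue_on S) \<and> integrable (lebesgue_on S) (\<lambda>x. (f x)\<^sup>2)"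

definition Linf_on :: "real set \<Rightarrow> (real \<Rightarrow> real) \<Rightarrow> bool" where
  "Linf_on S f \<longleftrightarrow> f \<in> borel_measurable (lebesgue_on S) \<and>
     (\<exists>C. AE x in lebesgue_on S. \<bar>f x\<bar> \<le> C)"

definition ddx :: "(real \<Rightarrow> real \<Rightarrow> 'b::real_normed_vector) \<Rightarrow> real \<Rightarrow> real \<Rightarrow> 'b" where
  "ddx f x t = vector_derivative (\<lambda>y. f y t) (at x)"

definition ddt :: "(real \<Rightarrow> real \<Rightarrow> 'b::real_normed_vector) \<Rightarrow> real \<Rightarrow> real \<Rightarrow> 'b" where
  "ddt f x t = vector_derivative (\<lambda>\<tau>. f x \<tau>) (at t within {0..})"

text \<open>
  A smooth solution on \<open>x > 0\<close>, \<open>t \<ge> 0\<close>. The smoothness conditions guarantee that all the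
  derivatives occurring in the equations exist, and the \<open>L\<^sup>2\<close> condition that the nonlocal
  coefficient is finite.
\<close>

definition smooth_solution ::
    "real \<Rightarrow> real \<Rightarrow> (real \<Rightarrow> real \<Rightarrow> complex) \<Rightarrow> (real \<Rightarrow> real \<Rightarrow> real) \<Rightarrow> bool" where
  "smooth_solution a b u v \<longleftrightarrow>
     Cinf_on (Rplus \<times> {0..}) (\<lambda>(x, t). u x t) \<and>
     Cinf_on (Rplus \<times> {0..}) (\<lambda>(x, t). v x t) \<and>
     (\<forall>t\<ge>0. L2_on Rplus (\<lambda>x. v x t)) \<and>
     (\<forall>x>0. \<forall>t\<ge>0.
        \<i> * ddt u x t + ddx (ddx u) x t
          = of_real ((cmod (u x t))\<^sup>2) * u x t + of_real b * u x t * of_real (v x t) \<and>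
        ddt v x t + a * (LINT y|lebesgue_on Rplus. (v y t)\<^sup>2) * ddx v x t
          = - b * ddx (\<lambda>y \<tau>. (cmod (u y \<tau>))\<^sup>2) x t)"

end

theory Submission
  imports Defs
begin

text \<open>
  We look for a standing wave: \<open>s = k = 0\<close>. With \<open>A = \<integral>w\<^sup>2\<close> and \<open>R = r(\<infinity>)\<close>, the second equation
  integrates to \<open>b w = c (R\<^sup>2 - r\<^sup>2)\<close> where \<open>c = b\<^sup>2 / (a A)\<close>, and the first becomes
  \<open>r'' = (\<omega> + c R\<^sup>2 + (1 - c) r\<^sup>2) r\<close>, which is solved by \<open>r = R tanh (\<mu> x)\<close> if \<open>\<mu> = m R\<close>,
  \<open>c = 1 - 2 m\<^sup>2\<close> and \<open>\<omega> = - R\<^sup>2\<close>. Since the integral of \<open>sech\<^sup>4 (\<mu> x)\<close> is \<open>2 / (3 \<mu>)\<close>, the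
  self-consistency condition for \<open>A\<close> reads \<open>R\<^sup>3 = 3 m b\<^sup>4 / (2 a c\<^sup>3)\<close>; it determines \<open>R > 0\<close> once
  \<open>m\<close> is chosen so that \<open>c\<close> has the sign of \<open>a\<close>.
  Smoothness holds because polynomials in \<open>tanh (\<mu> x)\<close> are closed under differentiation.
\<close>

section \<open>Smoothness of polynomials in \<open>tanh\<close>, with and without a phase
  factor\<close>

text \<open>If every member of a class has all its partial derivatives in the class again, induction
  on the order of differentiability applies to the whole class at once; order 0 holds because
  differentiable functions are continuous.\<close>

lemma Cinf_on_coinduct:
  assumes "X f"
    and step: "\<And>f. X f \<Longrightarrow> \<exists>D. (\<forall>i\<in>Basis. X (D i)) \<and>
          (\<forall>x\<in>S. (f has_derivative (\<lambda>h. \<Sum>i\<in>Basis. (h \<bullet> i) *\<^sub>R D i x)) (at x within S))"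
  shows "Cinf_on S f"
proof -
  have "Ck_on n S f" if "X f" for n f
    using that
  proof (induction n arbitrary: f)
    case 0
    from step[OF 0] show ?case
      unfolding Ck_on.simps continuous_on_eq_continuous_within
      by (blast intro: has_derivative_continuous)
  next
    case (Suc n)
    from step[OF Suc.prems] show ?case
      unfolding Ck_on.simps by (blast intro: Suc.IH)
  qed
  then show ?thesis
    using assms(1) by (simp add: Cinf_on_def)
qed

lemma inner_real_prod [simp]:
  "h \<bullet> (1, 0) = fst h" "h \<bullet> (0, 1) = snd h" for h :: "real \<times> real"
  by (cases h; simp)+

lemma Basis_real_prod: "(Basis :: (real \<times> real) set) = {(1, 0), (0, 1)}"
  by (auto simp: Basis_prod_def)

text \<open>This is d/dx transported to polynomials in T = tanh(\<mu> x), using T' = \<mu> (1 -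
  T^2). It turns the differential equations into polynomial identities in T.\<close>

definition tanh_pderiv :: "real \<Rightarrow> real poly \<Rightarrow> real poly" where
  "tanh_pderiv \<mu> P = smult \<mu> (pderiv P * [:1, 0, -1:])"

lemma has_real_derivative_poly_tanh:
  "((\<lambda>x. poly P (tanh (\<mu> * x))) has_real_derivative poly (tanh_pderiv \<mu> P) (tanh (\<mu> * x)))
     (at x within S)"
proof -
  have "((\<lambda>x. \<mu> * x) has_real_derivative \<mu>) (at x within S)"
    by (auto intro!: derivative_eq_intros)
  then have "((\<lambda>x. tanh (\<mu> * x)) has_real_derivative (1 - (tanh (\<mu> * x))\<^sup>2) * \<mu>) (at x within S)"
    by (rule has_field_derivative_tanh[rotated]) simp
  from DERIV_chain2[OF poly_DERIV this] show ?thesis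
    by (simp add: tanh_pderiv_def power2_eq_square algebra_simps)
qed

lemma Cinf_on_poly_tanh:
  fixes S :: "real set"
  shows "Cinf_on S (\<lambda>x. poly P (tanh (\<mu> * x)))"
proof (rule Cinf_on_coinduct[where X = "\<lambda>f. \<exists>P. f = (\<lambda>x :: real. poly P (tanh (\<mu> * x)))"])
  fix f :: "real \<Rightarrow> real"
  assume "\<exists>P. f = (\<lambda>x :: real. poly P (tanh (\<mu> * x)))"
  then obtain P where f: "f = (\<lambda>x. poly P (tanh (\<mu> * x)))" ..
  show "\<exists>D. (\<forall>i\<in>Basis. \<exists>P. D i = (\<lambda>x. poly P (tanh (\<mu> * x)))) \<and>
      (\<forall>x\<in>S. (f has_derivative (\<lambda>h. \<Sum>i\<in>Basis. (h \<bullet> i) *\<^sub>R D i x)) (at x within S))"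
    using has_real_derivative_poly_tanh[of P \<mu>]
    by (intro exI[of _ "\<lambda>_ x. poly (tanh_pderiv \<mu> P) (tanh (\<mu> * x))"])
      (auto simp: f has_field_derivative_def mult_commute_abs)
qed auto

lemma has_derivative_poly_tanh_fst:
  "((\<lambda>z. poly P (tanh (\<mu> * fst z))) has_derivative
      (\<lambda>h. poly (tanh_pderiv \<mu> P) (tanh (\<mu> * fst z)) * fst h)) (at z within S)"
  for z :: "real \<times> real"
  using has_derivative_compose[OF has_derivative_fst[OF has_derivative_ident]
      has_real_derivative_poly_tanh[of P \<mu> "fst z" UNIV, unfolded has_field_derivative_def]]
  by simp

lemma Cinf_on_poly_tanh_fst: "Cinf_on S (\<lambda>(x :: real, t :: real). poly P (tanh (\<mu> * x)))"
proof -
  let ?E = "\<lambda>P (x :: real, t :: real). poly P (tanh (\<mu> * x))"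
  show ?thesis
  proof (rule Cinf_on_coinduct[where X = "\<lambda>f. \<exists>P. f = ?E P"])
    fix f :: "real \<times> real \<Rightarrow> real"
    assume "\<exists>P. f = ?E P"
    then obtain P where f: "f = ?E P" by blast
    \<comment> \<open>The derivative in t vanishes; the zero polynomial keeps it inside the
      family.\<close>
    define D where "D i = ?E (if i = (1, 0) then tanh_pderiv \<mu> P else 0)" for i :: "real \<times> real"
    have "(f has_derivative (\<lambda>h. \<Sum>i\<in>Basis. (h \<bullet> i) *\<^sub>R D i z)) (at z within S)" for z
      using has_derivative_poly_tanh_fst[of P \<mu> z S]
      by (simp add: f D_def Basis_real_prod case_prod_unfold mult.commute)
    moreover have "\<exists>P. D i = ?E P" for i
      unfolding D_def by (rule exI, rule refl)
    ultimately show "\<exists>D. (\<forall>i\<in>Basis. \<exists>P. D i = ?E P) \<and>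
        (\<forall>x\<in>S. (f has_derivative (\<lambda>h. \<Sum>i\<in>Basis. (h \<bullet> i) *\<^sub>R D i x)) (at x within S))"
      by blast
  qed blast
qed

lemma has_vector_derivative_exp_i_times:
  "((\<lambda>t. exp (\<i> * of_real (\<omega> * t))) has_vector_derivative
      \<i> * of_real \<omega> * exp (\<i> * of_real (\<omega> * t))) (at t within S)"
proof -
  \<comment> \<open>Differentiate the entire function of a complex variable first, then restrict it
    to the real line.\<close>
  have "((\<lambda>z. exp (\<i> * (of_real \<omega> * z))) has_field_derivative
      \<i> * of_real \<omega> * exp (\<i> * (of_real \<omega> * of_real t))) (at (of_real t))"
    by (auto intro!: derivative_eq_intros simp: mult_ac)
  from has_vector_derivative_real_field[OF this] show ?thesis
    by simp
qed

text \<open>The free factor \<zeta> makes the family closed: the x-derivative changes only P, the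
  t-derivative only multiplies \<zeta> by \<i> \<omega>.\<close>

lemma Cinf_on_exp_poly_tanh:
  "Cinf_on S (\<lambda>(x, t). \<zeta> * exp (\<i> * of_real (\<omega> * t)) * of_real (poly P (tanh (\<mu> * x))))"
proof -
  let ?E = "\<lambda>\<zeta> P (x, t). \<zeta> * exp (\<i> * of_real (\<omega> * t)) * of_real (poly P (tanh (\<mu> * x)))"
  show ?thesis
  proof (rule Cinf_on_coinduct[where X = "\<lambda>f. \<exists>\<zeta> P. f = ?E \<zeta> P"])
    fix f :: "real \<times> real \<Rightarrow> complex"
    assume "\<exists>\<zeta> P. f = ?E \<zeta> P"
    then obtain \<zeta> P where f: "f = ?E \<zeta> P" by blast
    define D where "D i = ?E (if i = (1, 0) then \<zeta> else \<zeta> * \<i> * \<omega>) (if i = (1, 0) then tanh_pderiv \<mu> P else P)"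
      for i :: "real \<times> real"
    have "(f has_derivative (\<lambda>h. \<Sum>i\<in>Basis. (h \<bullet> i) *\<^sub>R D i z)) (at z within S)" for z
    proof -
      have "((\<lambda>z. exp (\<i> * of_real (\<omega> * snd z))) has_derivative
          (\<lambda>h. \<i> * of_real (\<omega> * snd h) * exp (\<i> * of_real (\<omega> * snd z)))) (at z within S)"
        using has_derivative_compose[OF has_derivative_snd[OF has_derivative_ident]
            has_vector_derivative_exp_i_times[of \<omega> "snd z" UNIV, unfolded has_vector_derivative_def]]
        by (simp add: scaleR_conv_of_real mult_ac)
      note has_derivative_mult[OF has_derivative_mult[OF has_derivative_const[of \<zeta>] this]
          has_derivative_of_real[OF has_derivative_poly_tanh_fst[of P \<mu>]]]
      then show ?thesis
        unfolding f case_prod_unfold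
        by (rule has_derivative_eq_rhs)
          (simp add: Basis_real_prod D_def fun_eq_iff case_prod_unfold
            scaleR_conv_of_real algebra_simps)
    qed
    moreover have "\<exists>\<zeta> P. D i = ?E \<zeta> P" for i
      unfolding D_def by (rule exI, rule exI, rule refl)
    ultimately show "\<exists>D. (\<forall>i\<in>Basis. \<exists>\<zeta> P. D i = ?E \<zeta> P) \<and>
        (\<forall>x\<in>S. (f has_derivative (\<lambda>h. \<Sum>i\<in>Basis. (h \<bullet> i) *\<^sub>R D i x)) (at x within S))"
      by blast
  qed blast
qed

section \<open>The integral of \<open>sech^4\<close> over the half-line\<close>

lemma has_bochner_integral_sech4:
  fixes \<mu> :: real
  assumes "\<mu> > 0"
  shows "has_bochner_integral (lebesgue_on {0<..}) (\<lambda>x. (1 - (tanh (\<mu> * x))\<^sup>2)\<^sup>2) (2 / (3 * \<mu>))"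
proof (rule has_bochner_integral_nn_integral)
  have cont: "continuous_on A (\<lambda>x. (1 - (tanh (\<mu> * x))\<^sup>2)\<^sup>2)" for A
    by (intro continuous_intros) auto
  show "(\<lambda>x. (1 - (tanh (\<mu> * x))\<^sup>2)\<^sup>2) \<in> borel_measurable (lebesgue_on {0<..})"
    by (rule continuous_imp_measurable_on_sets_lebesgue[OF cont]) auto
  \<comment> \<open>With T = tanh(\<mu> x), T' = \<mu> (1 - T^2) and d(T - T^3/3)/dT = 1 - T^2
    supply the two factors of the integrand.\<close>
  define F where "F x = (tanh (\<mu> * x) - (tanh (\<mu> * x))^3 / 3) / \<mu>" for x
  have F: "DERIV F x :> (1 - (tanh (\<mu> * x))\<^sup>2)\<^sup>2" for x
    unfolding F_def using assms
    by (auto intro!: derivative_eq_intros simp: field_simps power2_eq_square)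
  have "LIM x at_top. \<mu> * x :> at_top"
    by (intro filterlim_tendsto_pos_mult_at_top[OF tendsto_const assms filterlim_ident])
  from filterlim_compose[OF tanh_real_at_top this]
  have "((\<lambda>x. tanh (\<mu> * x)) \<longlongrightarrow> 1) at_top" .
  then have "(F \<longlongrightarrow> (1 - 1^3/3) / \<mu>) at_top"
    unfolding F_def using assms by (intro tendsto_intros) auto
  then have lim: "(F \<longlongrightarrow> 2 / (3 * \<mu>)) at_top"
    by simp
  have "(\<integral>\<^sup>+x. ennreal ((1 - (tanh (\<mu> * x))\<^sup>2)\<^sup>2) \<partial>lebesgue_on {0<..})
      = (\<integral>\<^sup>+x. ennreal ((1 - (tanh (\<mu> * x))\<^sup>2)\<^sup>2) * indicator {0<..} x \<partial>lborel)"
    by (simp add: nn_integral_restrict_space nn_integral_completion)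
  \<comment> \<open>Adding the null set {0} gives the closed half-line on which the fundamental
    theorem is applied.\<close>
  also have "\<dots> = (\<integral>\<^sup>+x. ennreal ((1 - (tanh (\<mu> * x))\<^sup>2)\<^sup>2) * indicator {0..} x \<partial>lborel)"
    using AE_lborel_singleton[of 0]
    by (intro nn_integral_cong_AE) (auto simp: indicator_def elim!: eventually_mono)
  also have "\<dots> = 2 / (3 * \<mu>) - F 0"
    using borel_measurable_continuous_onI[OF cont]
    by (intro nn_integral_FTC_atLeast F lim) auto
  finally show "(\<integral>\<^sup>+x. ennreal ((1 - (tanh (\<mu> * x))\<^sup>2)\<^sup>2) \<partial>lebesgue_on {0<..}) = ennreal (2 / (3 * \<mu>))"
    by (simp add: F_def)
qed (use assms in auto)

section \<open>Partial derivatives as they occur in the equations\<close>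

text \<open>Stated as an equality of functions of the same shape, so that rewriting twice yields the
  second x-derivative.\<close>

lemma ddx_exp_poly_tanh:
  "ddx (\<lambda>x t. exp (\<i> * of_real (\<omega> * t)) * of_real (poly P (tanh (\<mu> * x))))
    = (\<lambda>x t. exp (\<i> * of_real (\<omega> * t)) * of_real (poly (tanh_pderiv \<mu> P) (tanh (\<mu> * x))) :: complex)"
  unfolding ddx_def
  by (intro ext vector_derivative_at has_vector_derivative_mult_right has_vector_derivative_of_real)
    (simp add: has_real_derivative_poly_tanh flip: has_real_derivative_iff_has_vector_derivative)

lemma ddx_poly_tanh:
  "ddx (\<lambda>x t. poly P (tanh (\<mu> * x))) = (\<lambda>x t. poly (tanh_pderiv \<mu> P) (tanh (\<mu> * x)))"
  unfolding ddx_def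
  by (intro ext vector_derivative_at)
    (simp add: has_real_derivative_poly_tanh flip: has_real_derivative_iff_has_vector_derivative)

text \<open>Nontriviality of this filter makes the time derivative unique, including the one-sided
  one at t = 0.\<close>

lemma at_within_Ici_neq_bot: "at t within {0..} \<noteq> bot" if "t \<ge> 0" for t :: real
proof -
  have "at_right t \<le> at t within {0..}"
    using that by (intro at_le) auto
  then show ?thesis
    using trivial_limit_at_right_real[of t] by (metis bot_unique)
qed

lemma ddt_exp:
  fixes z :: "real \<Rightarrow> complex"
  assumes "t \<ge> 0"
  shows "ddt (\<lambda>x t. exp (\<i> * of_real (\<omega> * t)) * z x) x t = \<i> * \<omega> * exp (\<i> * of_real (\<omega> * t)) * z x"
proof -
  have "((\<lambda>t. exp (\<i> * of_real (\<omega> * t)) * z x) has_vector_derivative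
      \<i> * \<omega> * exp (\<i> * of_real (\<omega> * t)) * z x) (at t within {0..})"
    by (intro has_vector_derivative_mult_left has_vector_derivative_exp_i_times)
  then show ?thesis
    unfolding ddt_def using assms
    by (intro vector_derivative_within) (auto simp: at_within_Ici_neq_bot)
qed

lemma ddt_const:
  assumes "t \<ge> 0"
  shows "ddt (\<lambda>x t. z x) x t = 0"
  unfolding ddt_def using assms
  by (intro vector_derivative_within) (auto simp: at_within_Ici_neq_bot)

section \<open>Construction and verification of the standing wave\<close>

theorem theorem5p3:
  fixes a b :: real
  assumes "a \<noteq> 0" and "b \<noteq> 0"
  shows "\<exists>s k \<omega> :: real. s \<ge> 0 \<and>
    (\<exists>(u :: real \<Rightarrow> real \<Rightarrow> complex) (v :: real \<Rightarrow> real \<Rightarrow> real) (r :: real \<Rightarrow> real) (w :: real \<Rightarrow> real).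
       smooth_solution a b u v \<and>
       (\<forall>x>0. \<forall>t\<ge>0. u x t = exp (\<i> * of_real (\<omega> * t + k * x)) * of_real (r (x + s * t))) \<and>
       (\<forall>x>0. \<forall>t\<ge>0. v x t = w (x + s * t)) \<and>
       r 0 = 0 \<and> continuous_on {0..} r \<and> Linf_on Rplus r \<and> Cinf_on Rplus r \<and>
       strict_mono_on {0..} r \<and>
       (\<forall>t\<ge>0. L2_on Rplus (\<lambda>x. v x t) \<and> Cinf_on Rplus (\<lambda>x. v x t)))"
proof -
  \<comment> \<open>The two choices give c = 1/2 for positive a and c = -1 for negative a, hence a c
    > 0.\<close>
  define m :: real where "m = (if a > 0 then 1 / 2 else 1)"
  define c where "c = 1 - 2 * m\<^sup>2"
  have m: "m > 0" and c0: "c \<noteq> 0" and ac: "a * c > 0"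
    using assms by (auto simp: m_def c_def power2_eq_square)
  \<comment> \<open>The self-consistency condition solved for R; the radicand is positive because a
    c^3 has the sign of a c.\<close>
  define R where "R = root 3 (3 * m * b ^ 4 / (2 * (a * c ^ 3)))"
  have "a * c ^ 3 > 0"
    using ac by (auto simp: zero_less_mult_iff zero_less_power)
  then have "3 * m * b ^ 4 / (2 * (a * c ^ 3)) > 0"
    using m assms by (intro divide_pos_pos) auto
  then have R: "R > 0" and R3: "R ^ 3 = 3 * m * b ^ 4 / (2 * (a * c ^ 3))"
    by (auto simp: R_def)
  define \<mu> where "\<mu> = m * R"
  have \<mu>: "\<mu> > 0"
    using m R by (simp add: \<mu>_def)
  define \<omega> where "\<omega> = - R\<^sup>2"
  define P where "P = [:0, R:]"
  \<comment> \<open>This is (c/b) (R^2 - r^2) with r = R T, that is (c R^2 / b) (1 - T^2), so its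
    square is a multiple of \<open>sech^4\<close>.\<close>
  define W where "W = [:c * R\<^sup>2 / b, 0, - c * R\<^sup>2 / b:]"
  define r where "r x = poly P (tanh (\<mu> * x))" for x
  define w where "w x = poly W (tanh (\<mu> * x))" for x
  define u :: "real \<Rightarrow> real \<Rightarrow> complex" where "u x t = exp (\<i> * of_real (\<omega> * t)) * of_real (r x)" for x t
  define v where "v x t = w x" for x t :: real

  have w2: "(w x)\<^sup>2 = (c * R\<^sup>2 / b)\<^sup>2 * (1 - (tanh (\<mu> * x))\<^sup>2)\<^sup>2" for x
    unfolding power_mult_distrib[symmetric]
    by (simp add: w_def W_def power2_eq_square algebra_simps)
  have "has_bochner_integral (lebesgue_on Rplus) (\<lambda>x. (w x)\<^sup>2) ((c * R\<^sup>2 / b)\<^sup>2 * (2 / (3 * \<mu>)))"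
    unfolding w2 by (intro has_bochner_integral_mult_right has_bochner_integral_sech4 \<mu>)
  \<comment> \<open>Self-consistency: the mass A of \<open>w\<close> satisfies c = b^2 / (a A).
    Since \<mu> = m R, the left side depends on R only through R^3, whose value is prescribed by
    \<open>R3\<close>.\<close>
  moreover have "(c * R\<^sup>2 / b)\<^sup>2 * (2 / (3 * \<mu>)) = b\<^sup>2 / (a * c)"
  proof -
    have "(c * R\<^sup>2 / b)\<^sup>2 * (2 / (3 * \<mu>)) = 2 * c\<^sup>2 / (3 * m * b\<^sup>2) * R ^ 3"
      using R m assms by (simp add: \<mu>_def field_simps power2_eq_square power3_eq_cube)
    also have "\<dots> = b\<^sup>2 / (a * c)"
      unfolding R3 using m c0 assms
      by (simp add: field_simps power2_eq_square power3_eq_cube power4_eq_xxxx)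
    finally show ?thesis .
  qed
  ultimately have w_int: "has_bochner_integral (lebesgue_on Rplus) (\<lambda>x. (w x)\<^sup>2) (b\<^sup>2 / (a * c))"
    by simp
  have cont: "continuous_on A (\<lambda>x. poly Q (tanh (\<mu> * x)))" for A Q
    by (intro continuous_intros) auto
  have meas: "(\<lambda>x. poly Q (tanh (\<mu> * x))) \<in> borel_measurable (lebesgue_on Rplus)" for Q
    by (rule continuous_imp_measurable_on_sets_lebesgue[OF cont]) auto
  have L2: "L2_on Rplus w"
    using meas[of W] w_int by (auto simp: L2_on_def w_def[abs_def] has_bochner_integral_iff)
  have Linf: "Linf_on Rplus r"
    unfolding Linf_on_def
  proof (intro conjI exI AE_I2)
    show "r \<in> borel_measurable (lebesgue_on Rplus)"
      using meas[of P] by (simp add: r_def[abs_def])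
    show "\<bar>r x\<bar> \<le> R" for x
      using R tanh_real_lt_1[of "\<mu> * x"] tanh_real_gt_neg1[of "\<mu> * x"]
      by (simp add: r_def P_def abs_mult abs_le_iff mult_le_cancel_left2)
  qed

  have eq1: "\<i> * ddt u x t + ddx (ddx u) x t
      = of_real ((cmod (u x t))\<^sup>2) * u x t + of_real b * u x t * of_real (v x t)" if "t \<ge> 0" for x t
  proof -
    have u: "u = (\<lambda>x t. exp (\<i> * of_real (\<omega> * t)) * of_real (poly P (tanh (\<mu> * x))))"
      by (simp add: u_def r_def fun_eq_iff)
    have "ddt u x t = \<i> * \<omega> * u x t"
      using ddt_exp[OF that] by (simp add: u)
    moreover have "ddx (ddx u) x t = exp (\<i> * of_real (\<omega> * t)) *
        of_real (poly (tanh_pderiv \<mu> (tanh_pderiv \<mu> P)) (tanh (\<mu> * x)))"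
      unfolding u ddx_exp_poly_tanh ..
    \<comment> \<open>Both sides equal -2 m^2 R^2 (1 - T^2) r: on the left by differentiating R T
      twice, on the right because \<omega> = -R^2 and c - 1 = -2 m^2.\<close>
    moreover have "poly (tanh_pderiv \<mu> (tanh_pderiv \<mu> P)) (tanh (\<mu> * x)) = (\<omega> + (r x)\<^sup>2 + b * w x) * r x"
      using assms by (simp add: tanh_pderiv_def P_def W_def r_def w_def \<omega>_def \<mu>_def c_def
          pderiv_pCons power2_eq_square field_simps)
    moreover have "(cmod (u x t))\<^sup>2 = (r x)\<^sup>2"
      by (simp add: u_def norm_mult)
    ultimately show ?thesis
      by (simp add: u_def v_def algebra_simps)
  qed
  have eq2: "ddt v x t + a * (LINT y|lebesgue_on Rplus. (v y t)\<^sup>2) * ddx v x t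
      = - b * ddx (\<lambda>y \<tau>. (cmod (u y \<tau>))\<^sup>2) x t" if "t \<ge> 0" for x t
  proof -
    \<comment> \<open>The phase has modulus 1, so |u|^2 = r^2 is again a polynomial in T.\<close>
    have "(\<lambda>y \<tau>. (cmod (u y \<tau>))\<^sup>2) = (\<lambda>y \<tau>. poly (P\<^sup>2) (tanh (\<mu> * y)))"
      by (simp add: u_def r_def norm_mult fun_eq_iff)
    then have "ddx (\<lambda>y \<tau>. (cmod (u y \<tau>))\<^sup>2) x t = poly (tanh_pderiv \<mu> (P\<^sup>2)) (tanh (\<mu> * x))"
      by (simp only: ddx_poly_tanh)
    moreover have "ddx v x t = poly (tanh_pderiv \<mu> W) (tanh (\<mu> * x))"
      unfolding v_def[abs_def] w_def ddx_poly_tanh ..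
    moreover have "ddt v x t = 0"
      unfolding v_def[abs_def] by (rule ddt_const[OF that])
    moreover have "(LINT y|lebesgue_on Rplus. (v y t)\<^sup>2) = b\<^sup>2 / (a * c)"
      using w_int by (simp add: v_def has_bochner_integral_iff)
    \<comment> \<open>The coefficient b^2/c is a times the mass of \<open>w\<close>. Differentiating
      b W = c (R^2 - P^2) gives the identity.\<close>
    moreover have "b\<^sup>2 / c * poly (tanh_pderiv \<mu> W) T = - b * poly (tanh_pderiv \<mu> (P\<^sup>2)) T" for T
      using assms c0 by (simp add: tanh_pderiv_def P_def W_def pderiv_pCons power2_eq_square field_simps)
    ultimately show ?thesis
      using assms by simp
  qed

  have "Cinf_on S (\<lambda>(x, t). u x t)" for S
    using Cinf_on_exp_poly_tanh[of S 1 \<omega> P \<mu>] by (simp add: u_def r_def)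
  moreover have "Cinf_on S (\<lambda>(x, t). v x t)" for S
    using Cinf_on_poly_tanh_fst[of S W \<mu>] by (simp add: v_def w_def)
  moreover have L2_v: "L2_on Rplus (\<lambda>x. v x t)" for t
    using L2 by (simp add: v_def[abs_def])
  ultimately have "smooth_solution a b u v"
    unfolding smooth_solution_def using eq1 eq2 by simp
  moreover have "strict_mono_on {0..} r"
    using R \<mu> by (auto intro!: strict_mono_onI simp: r_def P_def)
  ultimately show ?thesis
    using L2_v Linf cont[of "{0..}" P] Cinf_on_poly_tanh[of _ P \<mu>] Cinf_on_poly_tanh[of _ W \<mu>]
    by (intro exI[of _ 0] exI[of _ \<omega>] exI[of _ u] exI[of _ v] exI[of _ r] exI[of _ w] conjI)
      (simp_all add: u_def v_def r_def[abs_def] w_def[abs_def] P_def)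
qed

end
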